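(* There exists an absolute constant $C>0$ such that the following holds. Let $A\in\{-1,1\}^{N\times N}$ be a random sign matrix whose entries are independent and uniform. Then with probability $1-o(1)$ as $N\to\infty$, $$h(A)\le C\log_2 N,$$ and in particular (on the same event) $$\operatorname{ind}_{\mathbb{Z}_2}(S(A))\le 2C\log_2 N .$$
   Context: Height. For $A\in\{-1,1,*\}^{M\times N}$ and each row $i\in[M]$ let $R_i^+=\{j\in[N]:A_{ij}=+1\}$ and $R_i^-=\{j\in[N]:A_{ij}=-1\}$. Let $\mathcal{R}(A)=\{R_i^+,R_i^-: i\in[M]\}$, and let $\mathcal{I}(A)$ be the family of all nonempty sets of the form $\bigcap_{t=1}^k F_t$ with $k\ge 1$ and $F_t\in\mathcal{R}(A)$. The height $h(A)$ is the maximum $k$ for which there is a strict chain $S_1\subsetneq S_2\subsetneq\cdots\subsetneq S_k$ with all $S_i\in\mathcal{I}(A)$. Sign complex. For each row $r$ of $A$, let $\sigma_r^+=\{i^+: r_i=+1\}\cup\{i^-: r_i=-1\}$ and $\sigma_r^-=\{i^-: r_i=+1\}\cup\{i^+: r_i=-1\}$, subsets of $\{1^+,1^-,\dots,N^+,N^-\}$. The sign complex $S(A)$ is the abstract simplicial complex whose simplices are all subsets of $\sigma_r^+$ or $\sigma_r^-$ over all rows $r$. The involution $i^+\leftrightarrow i^-$ is a free simplicial $\mathbb{Z}_2$-action on $S(A)$, inducing a free action on the geometric realization $|S(A)|$. Index. For a free $\mathbb{Z}_2$-complex $K$, $\operatorname{ind}_{\mathbb{Z}_2}(K)$ is the minimum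 $d\ge 0$ for which there is a continuous $\mathbb{Z}_2$-equivariant map $|K|\to\mathbb{S}^d$, where $\mathbb{S}^d$ carries the antipodal action. *)

theory Defs
  imports "HOL-Probability.Probability" "HOL-Probability.Product_PMF"
begin

section \<open>Partial sign matrices and their height\<close>

datatype sign_entry = Plus | Minus | Star

text \<open>
  An \<open>M \<times> N\<close> matrix is a function on all index pairs together with its dimensions \<open>M\<close> and \<open>N\<close>;
  only the entries at \<open>{1..M} \<times> {1..N}\<close> matter.
\<close>

type_synonym sign_matrix = "nat \<times> nat \<Rightarrow> sign_entry"

definition row_pos :: "nat \<Rightarrow> sign_matrix \<Rightarrow> nat \<Rightarrow> nat set" where
  "row_pos N A i = {j \<in> {1..N}. A (i, j) = Plus}"

definition row_neg :: "nat \<Rightarrow> sign_matrix \<Rightarrow> nat \<Rightarrow> nat set" where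
  "row_neg N A i = {j \<in> {1..N}. A (i, j) = Minus}"

definition row_family :: "nat \<Rightarrow> nat \<Rightarrow> sign_matrix \<Rightarrow> nat set set" where
  "row_family M N A = row_pos N A ` {1..M} \<union> row_neg N A ` {1..M}"

definition intersection_family :: "nat \<Rightarrow> nat \<Rightarrow> sign_matrix \<Rightarrow> nat set set" where
  "intersection_family M N A =
     {S. S \<noteq> {} \<and> (\<exists>\<F>. finite \<F> \<and> \<F> \<noteq> {} \<and> \<F> \<subseteq> row_family M N A \<and> S = \<Inter>\<F>)}"

definition is_strict_chain :: "'a set set \<Rightarrow> nat \<Rightarrow> (nat \<Rightarrow> 'a set) \<Rightarrow> bool" where
  "is_strict_chain \<I> k S \<longleftrightarrow> (\<forall>t\<in>{1..k}. S t \<in> \<I>) \<and> (\<forall>t\<in>{1..<k}. S t \<subset> S (Suc t))"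

text \<open>
  The empty chain (\<open>k = 0\<close>) is admitted, so the height is \<open>0\<close> if the intersection family is empty.
\<close>

definition sign_height :: "nat \<Rightarrow> nat \<Rightarrow> sign_matrix \<Rightarrow> nat" where
  "sign_height M N A = Max {k. \<exists>S. is_strict_chain (intersection_family M N A) k S}"

text \<open>The maximum is taken over a finite nonempty set.\<close>

lemma finite_intersection_family: "finite (intersection_family M N A)"
proof -
  have "finite (row_family M N A)"
    by (simp add: row_family_def)
  moreover have "intersection_family M N A \<subseteq> Inter ` Pow (row_family M N A)"
    by (auto simp: intersection_family_def)
  ultimately show ?thesis
    by (meson finite_Pow_iff finite_imageI finite_subset)
qed

lemma finite_chain_lengths:
  "finite {k. \<exists>S. is_strict_chain (intersection_family M N A) k S}"
proof (rule finite_subset)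
  show "{k. \<exists>S. is_strict_chain (intersection_family M N A) k S}
          \<subseteq> {..card (intersection_family M N A)}"
  proof clarify
    fix k S
    assume S: "is_strict_chain (intersection_family M N A) k S"
    have less: "S s \<subset> S t" if "1 \<le> s" "s < t" "t \<le> k" for s t
      using that(2,3)
    proof (induction t)
      case (Suc t)
      have "S t \<subset> S (Suc t)"
        using S Suc.prems that(1) by (auto simp: is_strict_chain_def)
      then show ?case
        using Suc by (cases "s = t") auto
    qed simp
    have "inj_on S {1..k}"
      by (rule linorder_inj_onI) (use less in fastforce)+
    then have "card {1..k} \<le> card (intersection_family M N A)"
      by (rule card_inj_on_le)
        (use S in \<open>auto simp: is_strict_chain_def finite_intersection_family\<close>)
    then show "k \<le> card (intersection_family M N A)"
      by simp
  qed
qed simp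

lemma zero_chain_length:
  "0 \<in> {k. \<exists>S. is_strict_chain (intersection_family M N A) k S}"
  by (simp add: is_strict_chain_def)


section \<open>The sign complex\<close>

text \<open>\<open>Pos i\<close> and \<open>Neg i\<close> stand for the vertices \<open>i\<^sup>+\<close> and \<open>i\<^sup>-\<close>.\<close>

datatype vertex = Pos nat | Neg nat

fun flip :: "vertex \<Rightarrow> vertex" where
  "flip (Pos i) = Neg i"
| "flip (Neg i) = Pos i"

definition sigma_pos :: "nat \<Rightarrow> sign_matrix \<Rightarrow> nat \<Rightarrow> vertex set" where
  "sigma_pos N A r = Pos ` row_pos N A r \<union> Neg ` row_neg N A r"

definition sigma_neg :: "nat \<Rightarrow> sign_matrix \<Rightarrow> nat \<Rightarrow> vertex set" where
  "sigma_neg N A r = Neg ` row_pos N A r \<union> Pos ` row_neg N A r"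

definition sign_complex :: "nat \<Rightarrow> nat \<Rightarrow> sign_matrix \<Rightarrow> vertex set set" where
  "sign_complex M N A = {\<tau>. \<exists>r\<in>{1..M}. \<tau> \<subseteq> sigma_pos N A r \<or> \<tau> \<subseteq> sigma_neg N A r}"

text \<open>The involution is a simplicial map of order two, and every simplex is disjoint from its image.\<close>

lemma flip_flip [simp]: "flip (flip v) = v"
  by (cases v) auto

lemma flip_sign_complex:
  assumes "\<tau> \<in> sign_complex M N A"
  shows "flip ` \<tau> \<in> sign_complex M N A"
proof -
  have "flip ` sigma_pos N A r = sigma_neg N A r" "flip ` sigma_neg N A r = sigma_pos N A r" for r
    by (auto simp: sigma_pos_def sigma_neg_def image_Un image_image)
  then show ?thesis
    using assms unfolding sign_complex_def by (smt (verit, best) image_mono mem_Collect_eq)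
qed

lemma flip_free:
  assumes "\<tau> \<in> sign_complex M N A"
  shows "flip ` \<tau> \<inter> \<tau> = {}"
proof -
  have "flip v \<notin> \<tau>" if "v \<in> \<tau>" for v
  proof
    assume "flip v \<in> \<tau>"
    with assms that obtain r where
      "v \<in> sigma_pos N A r \<and> flip v \<in> sigma_pos N A r \<or>
       v \<in> sigma_neg N A r \<and> flip v \<in> sigma_neg N A r"
      unfolding sign_complex_def by blast
    then show False
      by (auto simp: sigma_pos_def sigma_neg_def row_pos_def row_neg_def)
  qed
  then show ?thesis
    by auto
qed


section \<open>Geometric realization and index\<close>

text \<open>
  Points of the realization are given by barycentric coordinates. The topology is that of pointwise
  convergence of the coordinates, which for a finite complex (the only case used here) is the usual
  one.
\<close>

definition realization :: "'v set set \<Rightarrow> ('v \<Rightarrow> real) topology" where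
  "realization K = subtopology (powertop_real UNIV)
     {x. (\<forall>v. 0 \<le> x v) \<and> finite {v. x v \<noteq> 0} \<and> {v. x v \<noteq> 0} \<in> K \<and> (\<Sum>v | x v \<noteq> 0. x v) = 1}"

text \<open>
  A simplicial involution \<open>\<nu>\<close> acts on the realization by moving the coordinate at \<open>v\<close> to
  \<open>\<nu> v\<close>; since \<open>\<nu>\<close> is its own inverse, this is \<open>x \<mapsto> x \<circ> \<nu>\<close>. The library sphere \<open>nsphere d\<close> is the
  \<open>d\<close>-dimensional unit sphere, whose points are real sequences vanishing beyond index \<open>d\<close>.
\<close>

definition equivariant_to_sphere ::
    "'v set set \<Rightarrow> ('v \<Rightarrow> 'v) \<Rightarrow> nat \<Rightarrow> (('v \<Rightarrow> real) \<Rightarrow> nat \<Rightarrow> real) \<Rightarrow> bool" where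
  "equivariant_to_sphere K \<nu> d f \<longleftrightarrow>
     continuous_map (realization K) (nsphere d) f \<and>
     (\<forall>x \<in> topspace (realization K). f (x \<circ> \<nu>) = (\<lambda>i. - f x i))"

text \<open>The index is \<open>\<infinity>\<close> if there is no equivariant map to any sphere.\<close>

definition ind_Z2 :: "'v set set \<Rightarrow> ('v \<Rightarrow> 'v) \<Rightarrow> enat" where
  "ind_Z2 K \<nu> = Inf {enat d |d. \<exists>f. equivariant_to_sphere K \<nu> d f}"


section \<open>Random sign matrices\<close>

definition random_sign_matrix :: "nat \<Rightarrow> sign_matrix pmf" where
  "random_sign_matrix N =
     Pi_pmf ({1..N} \<times> {1..N}) Star (\<lambda>_. pmf_of_set {Plus, Minus})"

end

theory Submission
  imports Defs
begin

text \<open>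
  The constant \<open>C = 7\<close> works. Two independent facts are combined.

  For every matrix, random or not, the index of the sign complex is at most twice the height \<open>h\<close>
  (\<open>ind_Z2_sign_complex_le\<close>). To each face one assigns its hull, the intersection of the facets
  containing it. The positive and the negative vertices of a hull each form a set that is empty or
  lies in the intersection family, so the number of times such a set can grow along a chain is
  controlled by the height. Adding the depths of the two sets gives a rank between \<open>0\<close> and
  \<open>2 h\<close>, invariant under the involution, which can only stay the same along an inclusion of
  faces if the hull does. Together with a sign of the hull that the involution reverses, the rank
  turns the barycentric subdivision into a map to the boundary of the cross-polytope: a face goes
  to the vertex \<open>\<plusminus>e\<close> indexed by its rank, and no flag of faces contains both a vertex and its
  antipode. Normalising gives an explicit equivariant map to the sphere of dimension \<open>2 h\<close>
  (\<open>equivariant_to_sphere_from_ranking\<close>).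

  For a random matrix, a long chain forces a triangular pattern in the entries. If
  \<open>S\<^sub>1 \<subset> \<dots> \<subset> S\<^sub>m\<^sub>+\<^sub>1\<close>, then each strict step is witnessed by a half-row that contains the
  smaller set and a column of the larger set outside that half-row. This yields \<open>m\<close> distinct rows
  and \<open>m\<close> distinct columns such that, up to one sign per row, all \<open>m (m + 1) / 2\<close> entries on one
  side of the diagonal (inclusive) are prescribed (\<open>staircase_of_chain\<close>). There are only
  \<open>N\<^sup>2\<^sup>m 2\<^sup>m\<close> choices of rows, columns and signs, each of probability
  \<open>2\<close> to the power \<open>- m (m + 1) / 2\<close>, so the quadratic exponent beats the union bound as soon as
  \<open>m\<close> is a sufficiently large multiple of \<open>log 2 N\<close>.
\<close>

section \<open>Equivariant maps from signed rankings of faces\<close>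

text \<open>
  At a point \<open>x\<close> of the realization, the nonempty faces of nonzero weight are exactly the strict
  superlevel sets of the coordinates of \<open>x\<close>, that is, the flag whose barycenters span the simplex of the
  barycentric subdivision containing \<open>x\<close>. The true barycentric coordinate would be a difference of
  a minimum and a maximum. Only its support, its nonnegativity and its continuity matter here, and
  for a product of truncated differences they are immediate.
\<close>

definition level_weight :: "'v set \<Rightarrow> 'v set \<Rightarrow> ('v \<Rightarrow> real) \<Rightarrow> real" where
  "level_weight V \<sigma> x = (\<Prod>v\<in>\<sigma>. x v) * (\<Prod>v\<in>\<sigma>. \<Prod>u\<in>V - \<sigma>. max 0 (x v - x u))"

lemma continuous_on_level_weight: "continuous_on UNIV (level_weight V \<sigma>)"
proof -
  have c: "continuous_on UNIV (\<lambda>x::'a \<Rightarrow> real. x v)" for v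
    by (rule continuous_on_product_coordinates)
  show ?thesis
    unfolding level_weight_def
    by (intro continuous_intros c)
qed

lemma level_weight_nonneg:
  assumes "\<And>v. 0 \<le> x v"
  shows "0 \<le> level_weight V \<sigma> x"
  using assms by (auto simp: level_weight_def intro!: mult_nonneg_nonneg prod_nonneg)

lemma level_weight_nonzero_less:
  assumes "finite V" "\<sigma> \<subseteq> V" "level_weight V \<sigma> x \<noteq> 0" "v \<in> \<sigma>" "u \<in> V - \<sigma>"
  shows "x u < x v"
proof -
  have "finite \<sigma>"
    using assms finite_subset by blast
  then have "max 0 (x v - x u) \<noteq> 0"
    using assms by (auto simp: level_weight_def)
  then show ?thesis
    by (auto simp: max_def split: if_splits)
qed

text \<open>
  Superlevel sets of one function are nested: two vertices, each in just one of the two sets, would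
  have to have coordinates strictly larger than each other's.
\<close>

lemma level_weight_nonzero_chain:
  assumes "finite V" "\<sigma> \<subseteq> V" "\<tau> \<subseteq> V" "level_weight V \<sigma> x \<noteq> 0" "level_weight V \<tau> x \<noteq> 0"
  shows "\<sigma> \<subseteq> \<tau> \<or> \<tau> \<subseteq> \<sigma>"
proof (rule ccontr)
  assume "\<not> ?thesis"
  then obtain v u where "v \<in> \<sigma> - \<tau>" "u \<in> \<tau> - \<sigma>"
    by blast
  then have "x u < x v" "x v < x u"
    using level_weight_nonzero_less[OF assms(1,2,4), of v u]
      level_weight_nonzero_less[OF assms(1,3,5), of u v] assms(2,3) by auto
  then show False
    by simp
qed

lemma level_weight_comp:
  assumes "\<And>v. \<nu> (\<nu> v) = v" "\<nu> ` V = V"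
  shows "level_weight V (\<nu> ` \<sigma>) (x \<circ> \<nu>) = level_weight V \<sigma> x"
proof -
  have inj: "inj_on \<nu> B" for B
    by (metis assms(1) inj_onI)
  have "V - \<nu> ` \<sigma> = \<nu> ` (V - \<sigma>)"
    using inj[of UNIV] assms(2) by (metis image_set_diff)
  then show ?thesis
    by (simp add: level_weight_def prod.reindex[OF inj] assms(1) o_def)
qed

text \<open>
  The set where \<open>x\<close> attains its maximum is always a superlevel set. This provides the one
  contributing face needed to keep the map to the sphere away from the origin.
\<close>

lemma level_weight_top_level:
  assumes V: "finite V" and s: "{v. x v \<noteq> 0} \<subseteq> V" "{v. x v \<noteq> 0} \<noteq> {}" and x: "\<And>v. 0 \<le> x v"
  obtains \<sigma> where "\<sigma> \<noteq> {}" "\<sigma> \<subseteq> {v. x v \<noteq> 0}" "0 < level_weight V \<sigma> x"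
proof
  let ?s = "{v. x v \<noteq> 0}"
  define \<sigma> where "\<sigma> = {v \<in> ?s. x v = Max (x ` ?s)}"
  have fin: "finite ?s"
    using s V finite_subset by blast
  have "Max (x ` ?s) \<in> x ` ?s"
    using fin s by (intro Max_in) auto
  then show "\<sigma> \<noteq> {}"
    by (auto simp: \<sigma>_def)
  show "\<sigma> \<subseteq> ?s"
    by (auto simp: \<sigma>_def)
  have pos: "0 < x v" if "v \<in> \<sigma>" for v
    using that x[of v] by (auto simp: \<sigma>_def less_le)
  have "x u < x v" if v: "v \<in> \<sigma>" and u: "u \<in> V - \<sigma>" for u v
  proof (cases "u \<in> ?s")
    case True
    then have "x u \<le> Max (x ` ?s)" "x u \<noteq> Max (x ` ?s)"
      using fin u by (auto simp: \<sigma>_def)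
    then show ?thesis
      using v by (auto simp: \<sigma>_def)
  next
    case False
    then show ?thesis
      using pos[OF v] by simp
  qed
  then show "0 < level_weight V \<sigma> x"
    unfolding level_weight_def using pos by (auto intro!: mult_pos_pos prod_pos simp: less_max_iff_disj)
qed

text \<open>
  Sending each face to the basis vector indexed by its rank, with its sign, and extending with the
  level weights gives an odd continuous map to Euclidean space. It has no zero: the
  contributing faces form a flag, and within a flag all faces of one rank have the same sign, so
  nothing cancels in a coordinate that receives a contribution.
\<close>

theorem equivariant_to_sphere_from_ranking:
  fixes K :: "'v set set" and rank :: "'v set \<Rightarrow> nat" and e :: "'v set \<Rightarrow> real"
  assumes K: "finite K" "\<And>\<sigma>. \<sigma> \<in> K \<Longrightarrow> finite \<sigma>"
    and down: "\<And>\<sigma> \<tau>. \<sigma> \<in> K \<Longrightarrow> \<tau> \<subseteq> \<sigma> \<Longrightarrow> \<tau> \<in> K"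
    and \<nu>: "\<And>v. \<nu> (\<nu> v) = v" "\<And>\<sigma>. \<sigma> \<in> K \<Longrightarrow> \<nu> ` \<sigma> \<in> K"
    and rank: "\<And>\<sigma>. \<sigma> \<in> K \<Longrightarrow> \<sigma> \<noteq> {} \<Longrightarrow> rank \<sigma> \<le> d"
      "\<And>\<sigma>. \<sigma> \<in> K \<Longrightarrow> \<sigma> \<noteq> {} \<Longrightarrow> rank (\<nu> ` \<sigma>) = rank \<sigma>"
    and e: "\<And>\<sigma>. \<sigma> \<in> K \<Longrightarrow> \<sigma> \<noteq> {} \<Longrightarrow> e \<sigma> \<noteq> 0"
      "\<And>\<sigma>. \<sigma> \<in> K \<Longrightarrow> \<sigma> \<noteq> {} \<Longrightarrow> e (\<nu> ` \<sigma>) = - e \<sigma>"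
    and same: "\<And>\<sigma> \<tau>. \<tau> \<in> K \<Longrightarrow> \<sigma> \<noteq> {} \<Longrightarrow> \<sigma> \<subseteq> \<tau> \<Longrightarrow> rank \<sigma> = rank \<tau> \<Longrightarrow> e \<sigma> = e \<tau>"
  shows "\<exists>f. equivariant_to_sphere K \<nu> d f"
proof -
  define V where "V = \<Union>K"
  define F where "F = K - {{}}"
  define w where "w = level_weight V"
  define f where "f x k = (\<Sum>\<sigma>\<in>F. if rank \<sigma> = k then e \<sigma> * w \<sigma> x else 0)" for x k
  define n where "n x = sqrt (\<Sum>i\<le>d. (f x i)\<^sup>2)" for x
  have fV: "finite V" and fF: "finite F"
    using K by (auto simp: V_def F_def)
  have subV: "\<sigma> \<subseteq> V" if "\<sigma> \<in> F" for \<sigma>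
    using that by (auto simp: V_def F_def)
  have \<nu>V: "\<nu> ` V = V"
  proof -
    have "\<nu> ` V \<subseteq> V"
      using \<nu>(2) by (auto simp: V_def)
    moreover from this have "V \<subseteq> \<nu> ` V"
      by (metis \<nu>(1) image_eqI image_subset_iff subsetI)
    ultimately show ?thesis
      by blast
  qed
  have \<nu>inv: "\<nu> ` \<nu> ` \<sigma> = \<sigma>" for \<sigma>
    by (simp add: image_image \<nu>)
  have \<nu>F: "\<nu> ` \<sigma> \<in> F" if "\<sigma> \<in> F" for \<sigma>
    using that \<nu> by (auto simp: F_def)
  have bij: "bij_betw ((`) \<nu>) F F"
    by (rule bij_betwI[where g = "(`) \<nu>"]) (auto simp: \<nu>inv \<nu>F)
  have zero: "f x k = 0" if "k > d" for x k
  proof -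
    have "rank \<sigma> \<noteq> k" if "\<sigma> \<in> F" for \<sigma>
      using rank(1)[of \<sigma>] that \<open>k > d\<close> by (auto simp: F_def)
    then show ?thesis
      by (simp add: f_def)
  qed
  have cont_f: "continuous_on UNIV (\<lambda>x. f x k)" for k
  proof -
    have "continuous_on UNIV (\<lambda>x. if rank \<sigma> = k then e \<sigma> * w \<sigma> x else 0)" for \<sigma>
      using continuous_on_level_weight[of V \<sigma>]
      by (cases "rank \<sigma> = k") (auto simp: w_def intro!: continuous_on_mult_left)
    then show ?thesis
      unfolding f_def by (intro continuous_on_sum)
  qed
  have cont_n: "continuous_on UNIV n"
    unfolding n_def by (intro continuous_intros cont_f)
  have odd: "f (x \<circ> \<nu>) k = - f x k" for x k
  proof -
    have "f (x \<circ> \<nu>) k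
        = (\<Sum>\<sigma>\<in>F. if rank (\<nu> ` \<sigma>) = k then e (\<nu> ` \<sigma>) * w (\<nu> ` \<sigma>) (x \<circ> \<nu>) else 0)"
      unfolding f_def by (rule sum.reindex_bij_betw[OF bij, symmetric])
    also have "\<dots> = (\<Sum>\<sigma>\<in>F. - (if rank \<sigma> = k then e \<sigma> * w \<sigma> x else 0))"
      using rank(2) e(2)
      by (intro sum.cong refl) (auto simp: F_def w_def level_weight_comp[OF \<nu>(1) \<nu>V])
    finally show ?thesis
      by (simp add: f_def sum_negf)
  qed
  have n_comp: "n (x \<circ> \<nu>) = n x" for x
    by (simp add: n_def odd)
  have n_pos: "0 < n x" if x: "x \<in> topspace (realization K)" for x
  proof -
    let ?s = "{v. x v \<noteq> 0}"
    have nn: "0 \<le> x v" for v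
      using x by (auto simp: realization_def)
    have s: "?s \<in> K" "sum x ?s = 1"
      using x by (auto simp: realization_def)
    then have "?s \<noteq> {}"
      by (metis sum.empty zero_neq_one)
    then obtain \<sigma> where \<sigma>: "\<sigma> \<noteq> {}" "\<sigma> \<subseteq> ?s" "0 < w \<sigma> x"
      using level_weight_top_level[of V x] s nn fV unfolding w_def V_def by blast
    have \<sigma>F: "\<sigma> \<in> F"
      using \<sigma> down[OF s(1)] by (auto simp: F_def)
    \<comment> \<open>All faces contributing to this coordinate are comparable with \<open>\<sigma>\<close> and hence carry its sign.\<close>
    have "f x (rank \<sigma>) = (\<Sum>\<tau>\<in>F. if rank \<tau> = rank \<sigma> then e \<sigma> * w \<tau> x else 0)"
      unfolding f_def
    proof (intro sum.cong refl)
      fix \<tau> assume \<tau>: "\<tau> \<in> F"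
      have "e \<tau> = e \<sigma>" if "rank \<tau> = rank \<sigma>" "w \<tau> x \<noteq> 0"
      proof -
        have "\<sigma> \<subseteq> \<tau> \<or> \<tau> \<subseteq> \<sigma>"
          using level_weight_nonzero_chain[OF fV subV[OF \<sigma>F] subV[OF \<tau>], of x] \<sigma>(3) that
          by (simp add: w_def)
        then show ?thesis
          using same[of \<tau> \<sigma>] same[of \<sigma> \<tau>] that(1) \<sigma>F \<tau> by (auto simp: F_def)
      qed
      then show "(if rank \<tau> = rank \<sigma> then e \<tau> * w \<tau> x else 0)
          = (if rank \<tau> = rank \<sigma> then e \<sigma> * w \<tau> x else 0)"
        by auto
    qed
    also have "\<dots> = e \<sigma> * (\<Sum>\<tau>\<in>F. if rank \<tau> = rank \<sigma> then w \<tau> x else 0)"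
      by (auto simp: sum_distrib_left intro!: sum.cong)
    finally have eq: "f x (rank \<sigma>) = e \<sigma> * (\<Sum>\<tau>\<in>F. if rank \<tau> = rank \<sigma> then w \<tau> x else 0)" .
    have "0 < (\<Sum>\<tau>\<in>F. if rank \<tau> = rank \<sigma> then w \<tau> x else 0)"
      using \<sigma>F \<sigma>(3) level_weight_nonneg[of x V] nn
      by (intro sum_pos2[OF fF, of \<sigma>]) (auto simp: w_def)
    then have "f x (rank \<sigma>) \<noteq> 0"
      using eq e(1)[of \<sigma>] \<sigma>F by (auto simp: F_def)
    then have "0 < (\<Sum>i\<le>d. (f x i)\<^sup>2)"
      using rank(1)[of \<sigma>] \<sigma>F by (intro sum_pos2[of _ "rank \<sigma>"]) (auto simp: F_def)
    then show ?thesis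
      by (simp add: n_def)
  qed
  define g where "g x = (\<lambda>k. f x k / n x)" for x
  have "continuous_map (realization K) (nsphere d) g"
    unfolding nsphere continuous_map_in_subtopology
  proof
    have "continuous_map (realization K) euclideanreal (\<lambda>x. g x k)" for k
    proof -
      have top: "realization K = top_of_set (topspace (realization K))"
        by (auto simp: realization_def euclidean_product_topology)
      have "continuous_on (topspace (realization K)) (\<lambda>x. g x k)"
        unfolding g_def using n_pos
        by (intro continuous_on_divide continuous_on_subset[OF cont_f] continuous_on_subset[OF cont_n])
          (auto dest: n_pos)
      then show ?thesis
        by (subst top) simp
    qed
    then show "continuous_map (realization K) (powertop_real UNIV) g"
      by (simp add: continuous_map_componentwise_UNIV)
    show "g \<in> topspace (realization K) \<rightarrow> {x. (\<Sum>i\<le>d. (x i)\<^sup>2) = 1 \<and> (\<forall>i>d. x i = 0)}"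
    proof clarify
      fix x assume x: "x \<in> topspace (realization K)"
      have "(\<Sum>i\<le>d. (g x i)\<^sup>2) = (\<Sum>i\<le>d. (f x i)\<^sup>2) / (n x)\<^sup>2"
        by (simp add: g_def power_divide sum_divide_distrib)
      also have "(n x)\<^sup>2 = (\<Sum>i\<le>d. (f x i)\<^sup>2)"
        by (simp add: n_def sum_nonneg)
      also have "\<dots> / \<dots> = 1"
        using n_pos[OF x] by (simp add: n_def)
      finally show "(\<Sum>i\<le>d. (g x i)\<^sup>2) = 1 \<and> (\<forall>i>d. g x i = 0)"
        by (simp add: g_def zero)
    qed
  qed
  moreover have "g (x \<circ> \<nu>) = (\<lambda>i. - g x i)" for x
    by (simp add: g_def odd n_comp)
  ultimately show ?thesis
    unfolding equivariant_to_sphere_def by blast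
qed

section \<open>The index is at most twice the height\<close>

text \<open>
  The depth bounds chains by \<open>S\<close> from above and does not require \<open>S\<close> itself to belong to the
  family, so it is also defined, with value \<open>0\<close>, for the empty part of a hull.
\<close>

definition depth :: "nat \<Rightarrow> nat \<Rightarrow> sign_matrix \<Rightarrow> nat set \<Rightarrow> nat" where
  "depth M N A S =
     Max {k. \<exists>c. is_strict_chain (intersection_family M N A) k c \<and> (\<forall>t\<in>{1..k}. c t \<subseteq> S)}"

lemma
  shows finite_depth_set: "finite {k. \<exists>c. is_strict_chain (intersection_family M N A) k c \<and>
      (\<forall>t\<in>{1..k}. c t \<subseteq> S)}" (is "finite ?D")
    and depth_set_nonempty: "{k. \<exists>c. is_strict_chain (intersection_family M N A) k c \<and>
      (\<forall>t\<in>{1..k}. c t \<subseteq> S)} \<noteq> {}"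
proof -
  show "finite ?D"
    by (rule finite_subset[OF _ finite_chain_lengths[of M N A]]) auto
  have "0 \<in> ?D"
    by (simp add: is_strict_chain_def)
  then show "?D \<noteq> {}"
    by blast
qed

lemma depth_mono: "S \<subseteq> T \<Longrightarrow> depth M N A S \<le> depth M N A T"
  unfolding depth_def
  by (rule Max_mono[OF _ depth_set_nonempty finite_depth_set]) blast

lemma depth_le_sign_height: "depth M N A S \<le> sign_height M N A"
  unfolding depth_def sign_height_def
  by (rule Max_mono[OF _ depth_set_nonempty finite_chain_lengths]) blast

lemma depth_strict_mono:
  assumes "S \<subset> T" and T: "T \<in> intersection_family M N A"
  shows "depth M N A S < depth M N A T"
proof -
  let ?k = "depth M N A S"
  have "?k \<in> {k. \<exists>c. is_strict_chain (intersection_family M N A) k c \<and> (\<forall>t\<in>{1..k}. c t \<subseteq> S)}"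
    unfolding depth_def by (rule Max_in[OF finite_depth_set depth_set_nonempty])
  then obtain c where c: "is_strict_chain (intersection_family M N A) ?k c" "\<forall>t\<in>{1..?k}. c t \<subseteq> S"
    by blast
  let ?c = "c(Suc ?k := T)"
  have "c ?k \<subset> T" if "1 \<le> ?k"
  proof -
    have "c ?k \<subseteq> S"
      using c(2) that by simp
    then show ?thesis
      using assms(1) by blast
  qed
  then have "is_strict_chain (intersection_family M N A) (Suc ?k) ?c"
    using c assms unfolding is_strict_chain_def
    by (auto simp: less_Suc_eq le_Suc_eq)
  moreover have "\<forall>t\<in>{1..Suc ?k}. ?c t \<subseteq> T"
  proof
    fix t assume "t \<in> {1..Suc ?k}"
    then consider "t = Suc ?k" | "t \<in> {1..?k}"
      by force
    then show "?c t \<subseteq> T"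
    proof cases
      case 2
      then have "?c t \<subseteq> S"
        using c(2) by simp
      then show ?thesis
        using assms(1) by blast
    qed simp
  qed
  ultimately have "Suc ?k \<le> depth M N A T"
    unfolding depth_def[of _ _ _ T] by (intro Max_ge[OF finite_depth_set]) blast
  then show ?thesis
    by simp
qed

definition facets :: "nat \<Rightarrow> nat \<Rightarrow> sign_matrix \<Rightarrow> vertex set set" where
  "facets M N A = sigma_pos N A ` {1..M} \<union> sigma_neg N A ` {1..M}"

text \<open>
  Faces with the same hull have to be treated alike: flags of faces can have length up to \<open>N\<close>,
  while the chains of hulls have a length controlled by the height.
\<close>

definition facet_hull :: "nat \<Rightarrow> nat \<Rightarrow> sign_matrix \<Rightarrow> vertex set \<Rightarrow> vertex set" where
  "facet_hull M N A \<sigma> = \<Inter>{\<phi> \<in> facets M N A. \<sigma> \<subseteq> \<phi>}"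

lemma sign_complex_iff_facets: "\<tau> \<in> sign_complex M N A \<longleftrightarrow> (\<exists>\<phi>\<in>facets M N A. \<tau> \<subseteq> \<phi>)"
  by (auto simp: sign_complex_def facets_def)

lemma finite_facets: "finite (facets M N A)"
  by (simp add: facets_def)

lemma finite_facet: "\<phi> \<in> facets M N A \<Longrightarrow> finite \<phi>"
  by (auto simp: facets_def sigma_pos_def sigma_neg_def row_pos_def row_neg_def)

lemma finite_sign_complex: "finite (sign_complex M N A)"
proof -
  have "sign_complex M N A \<subseteq> (\<Union>\<phi>\<in>facets M N A. Pow \<phi>)"
    by (auto simp: sign_complex_iff_facets)
  moreover have "finite (\<Union>\<phi>\<in>facets M N A. Pow \<phi>)"
    using finite_facets finite_facet by auto
  ultimately show ?thesis
    using finite_subset by blast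
qed

lemma flip_image_sigma:
  "flip ` sigma_pos N A r = sigma_neg N A r" "flip ` sigma_neg N A r = sigma_pos N A r"
  by (auto simp: sigma_pos_def sigma_neg_def image_Un image_image)

lemma flip_image_facets: "(`) flip ` facets M N A = facets M N A"
  by (auto simp: facets_def image_Un image_image flip_image_sigma)

lemma flip_image_vimage: "flip ` X = flip -` X"
  by (metis (no_types, lifting) bij_vimage_eq_inv_image flip_flip inv_unique_comp o_bij comp_def id_def ext)

lemma flip_image_mem [simp]: "Pos j \<in> flip ` X \<longleftrightarrow> Neg j \<in> X" "Neg j \<in> flip ` X \<longleftrightarrow> Pos j \<in> X"
  by (simp_all add: flip_image_vimage)

lemma facet_hull_mono: "\<sigma> \<subseteq> \<tau> \<Longrightarrow> facet_hull M N A \<sigma> \<subseteq> facet_hull M N A \<tau>"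
  by (auto simp: facet_hull_def)

lemma facet_hull_extensive: "\<sigma> \<subseteq> facet_hull M N A \<sigma>"
  by (auto simp: facet_hull_def)

lemma facet_hull_in_sign_complex:
  "\<sigma> \<in> sign_complex M N A \<Longrightarrow> facet_hull M N A \<sigma> \<in> sign_complex M N A"
  by (auto simp: sign_complex_iff_facets facet_hull_def)

lemma facet_hull_flip: "facet_hull M N A (flip ` \<sigma>) = flip ` facet_hull M N A \<sigma>"
proof -
  have "{\<phi> \<in> facets M N A. flip ` \<sigma> \<subseteq> \<phi>} = (`) flip ` {\<phi> \<in> facets M N A. \<sigma> \<subseteq> \<phi>}"
  proof -
    have "flip ` \<sigma> \<subseteq> flip ` \<phi> \<longleftrightarrow> \<sigma> \<subseteq> \<phi>" for \<phi>
      by (metis flip_flip image_mono inj_image_subset_iff inj_def)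
    then show ?thesis
      by (subst (1) flip_image_facets[symmetric]) auto
  qed
  then show ?thesis
    by (auto simp: facet_hull_def flip_image_vimage)
qed

text \<open>
  The positive vertices of a facet form one half of a row, so intersecting facets intersects
  half-rows. Only the emptiness of the result can prevent it from lying in the intersection family.
\<close>

lemma Pos_vimage_facet_hull:
  assumes "\<sigma> \<in> sign_complex M N A" "Pos -` facet_hull M N A \<sigma> \<noteq> {}"
  shows "Pos -` facet_hull M N A \<sigma> \<in> intersection_family M N A"
proof -
  let ?F = "(\<lambda>\<phi>. Pos -` \<phi>) ` {\<phi> \<in> facets M N A. \<sigma> \<subseteq> \<phi>}"
  have "Pos -` sigma_pos N A r = row_pos N A r" "Pos -` sigma_neg N A r = row_neg N A r" for r
    by (auto simp: sigma_pos_def sigma_neg_def)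
  then have "?F \<subseteq> row_family M N A"
    by (auto simp: facets_def row_family_def)
  moreover have "?F \<noteq> {}"
    using assms(1) by (auto simp: sign_complex_iff_facets)
  moreover have "finite ?F"
    using finite_facets by simp
  moreover have "Pos -` facet_hull M N A \<sigma> = \<Inter>?F"
    by (auto simp: facet_hull_def)
  ultimately show ?thesis
    using assms(2) unfolding intersection_family_def by blast
qed

lemma Neg_vimage_eq: "Neg -` X = Pos -` (flip ` X)"
  by (simp add: vimage_def)

lemma Neg_vimage_facet_hull:
  assumes "\<sigma> \<in> sign_complex M N A" "Neg -` facet_hull M N A \<sigma> \<noteq> {}"
  shows "Neg -` facet_hull M N A \<sigma> \<in> intersection_family M N A"
  using Pos_vimage_facet_hull[OF flip_sign_complex[OF assms(1)]] assms(2)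
  by (simp add: facet_hull_flip flip: Neg_vimage_eq)

definition face_rank :: "nat \<Rightarrow> nat \<Rightarrow> sign_matrix \<Rightarrow> vertex set \<Rightarrow> nat" where
  "face_rank M N A \<sigma> =
     depth M N A (Pos -` facet_hull M N A \<sigma>) + depth M N A (Neg -` facet_hull M N A \<sigma>)"

text \<open>
  Any choice of one element from each antipodal pair of hulls would do; the sign of the smallest
  index occurring in the hull makes the choice explicit.
\<close>

definition leading_sign :: "vertex set \<Rightarrow> real" where
  "leading_sign c = (if Pos (LEAST j. Pos j \<in> c \<or> Neg j \<in> c) \<in> c then 1 else - 1)"

lemma leading_sign_flip:
  assumes "c \<noteq> {}" "flip ` c \<inter> c = {}"
  shows "leading_sign (flip ` c) = - leading_sign c"
proof -
  let ?j = "LEAST j. Pos j \<in> c \<or> Neg j \<in> c"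
  obtain v where "v \<in> c"
    using assms(1) by blast
  then have "\<exists>j. Pos j \<in> c \<or> Neg j \<in> c"
    by (cases v) auto
  then have "Pos ?j \<in> c \<or> Neg ?j \<in> c"
    by (rule LeastI_ex)
  moreover have "\<not> (Pos ?j \<in> c \<and> Neg ?j \<in> c)"
    using assms(2) flip_image_mem(1)[of ?j c] by blast
  moreover have "(LEAST j. Neg j \<in> c \<or> Pos j \<in> c) = ?j"
    by (simp add: disj_commute)
  ultimately show ?thesis
    by (auto simp: leading_sign_def)
qed

text \<open>
  If the hull grows, then its positive or its negative part grows, and the larger part is then
  nonempty and so belongs to the intersection family. Hence its depth strictly increases, while
  the depth of the other part does not decrease.
\<close>

lemma facet_hull_eq_if_face_rank_eq:
  assumes \<tau>: "\<tau> \<in> sign_complex M N A" and sub: "\<sigma> \<subseteq> \<tau>"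
    and eq: "face_rank M N A \<sigma> = face_rank M N A \<tau>"
  shows "facet_hull M N A \<sigma> = facet_hull M N A \<tau>"
proof -
  let ?h = "facet_hull M N A"
  have P: "Pos -` ?h \<sigma> \<subseteq> Pos -` ?h \<tau>" and Q: "Neg -` ?h \<sigma> \<subseteq> Neg -` ?h \<tau>"
    using facet_hull_mono[OF sub, of M N A] by auto
  have "Pos -` ?h \<sigma> = Pos -` ?h \<tau>"
  proof (rule ccontr)
    assume "Pos -` ?h \<sigma> \<noteq> Pos -` ?h \<tau>"
    then have s: "Pos -` ?h \<sigma> \<subset> Pos -` ?h \<tau>"
      using P by blast
    then have "Pos -` ?h \<tau> \<in> intersection_family M N A"
      by (intro Pos_vimage_facet_hull \<tau>) blast
    from depth_strict_mono[OF s this] depth_mono[OF Q, of M N A] eq show False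
      by (simp add: face_rank_def)
  qed
  moreover have "Neg -` ?h \<sigma> = Neg -` ?h \<tau>"
  proof (rule ccontr)
    assume "Neg -` ?h \<sigma> \<noteq> Neg -` ?h \<tau>"
    then have s: "Neg -` ?h \<sigma> \<subset> Neg -` ?h \<tau>"
      using Q by blast
    then have "Neg -` ?h \<tau> \<in> intersection_family M N A"
      by (intro Neg_vimage_facet_hull \<tau>) blast
    from depth_strict_mono[OF s this] depth_mono[OF P, of M N A] eq show False
      by (simp add: face_rank_def)
  qed
  ultimately have "v \<in> ?h \<sigma> \<longleftrightarrow> v \<in> ?h \<tau>" for v
    by (cases v) blast+
  then show ?thesis
    by blast
qed

theorem ind_Z2_sign_complex_le:
  "ind_Z2 (sign_complex M N A) flip \<le> enat (2 * sign_height M N A)"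
proof -
  let ?h = "facet_hull M N A"
  have flip: "?h (flip ` \<sigma>) = flip ` ?h \<sigma>" for \<sigma>
    by (rule facet_hull_flip)
  have "\<exists>f. equivariant_to_sphere (sign_complex M N A) flip (2 * sign_height M N A) f"
  proof (rule equivariant_to_sphere_from_ranking[where
        rank = "face_rank M N A" and e = "\<lambda>\<sigma>. leading_sign (?h \<sigma>)"])
    fix \<sigma> assume \<sigma>: "\<sigma> \<in> sign_complex M N A"
    show "finite \<sigma>"
      using \<sigma> finite_facet finite_subset by (fastforce simp: sign_complex_iff_facets)
    show "face_rank M N A \<sigma> \<le> 2 * sign_height M N A"
      unfolding face_rank_def by (metis add_mono depth_le_sign_height mult_2)
    show "face_rank M N A (flip ` \<sigma>) = face_rank M N A \<sigma>"
      by (simp add: face_rank_def flip image_image flip: Neg_vimage_eq)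
        (simp add: Neg_vimage_eq image_image)
    show "leading_sign (?h (flip ` \<sigma>)) = - leading_sign (?h \<sigma>)" if "\<sigma> \<noteq> {}"
      unfolding flip
      using that facet_hull_extensive[of \<sigma> M N A] flip_free[OF facet_hull_in_sign_complex[OF \<sigma>]]
      by (intro leading_sign_flip) auto
    show "leading_sign (?h \<sigma>) \<noteq> 0"
      by (simp add: leading_sign_def)
    show "flip ` \<sigma> \<in> sign_complex M N A"
      using \<sigma> by (rule flip_sign_complex)
    show "\<tau> \<in> sign_complex M N A" if "\<tau> \<subseteq> \<sigma>" for \<tau>
      using \<sigma> that unfolding sign_complex_iff_facets by blast
    show "leading_sign (?h \<tau>) = leading_sign (?h \<sigma>)"
      if "\<tau> \<subseteq> \<sigma>" "face_rank M N A \<tau> = face_rank M N A \<sigma>" for \<tau>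
      using facet_hull_eq_if_face_rank_eq[OF \<sigma> that] by simp
  qed (simp_all add: finite_sign_complex)
  then show ?thesis
    unfolding ind_Z2_def by (intro Inf_lower) auto
qed

section \<open>Long chains force staircase patterns\<close>

fun opposite :: "sign_entry \<Rightarrow> sign_entry" where
  "opposite Plus = Minus"
| "opposite Minus = Plus"
| "opposite Star = Star"

text \<open>
  This is the trace that a chain leaves in the matrix. The sign of each row is a parameter, although
  the pattern determines it, because for fixed \<open>r\<close>, \<open>x\<close> and \<open>g\<close> the event prescribes the value of
  each cell of a triangle and its probability is a product over these cells.
\<close>

definition staircase ::
    "nat \<Rightarrow> sign_matrix \<Rightarrow> (nat \<Rightarrow> nat) \<Rightarrow> (nat \<Rightarrow> nat) \<Rightarrow> (nat \<Rightarrow> sign_entry) \<Rightarrow> bool" where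
  "staircase m A r x g \<longleftrightarrow>
     (\<forall>t<m. \<forall>s\<le>t. A (r t, x s) = (if s < t then g t else opposite (g t)))"

text \<open>
  Since \<open>S (t + 1)\<close> is an intersection of half-rows that does not contain \<open>S (t + 2)\<close>, some
  half-row, in row \<open>r t\<close> with sign \<open>g t\<close>, contains the former set but misses a column \<open>x t\<close> of the
  latter. The earlier columns \<open>x s\<close> lie in \<open>S (s + 2) \<subseteq> S (t + 1)\<close>, where row \<open>r t\<close> is
  constantly \<open>g t\<close>. Without stars, missing a half-row means having the opposite sign.
\<close>

lemma staircase_of_chain:
  assumes chain: "is_strict_chain (intersection_family M N A) (Suc m) S"
    and total: "\<And>i j. i \<in> {1..M} \<Longrightarrow> j \<in> {1..N} \<Longrightarrow> A (i, j) \<in> {Plus, Minus}"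
  obtains r x g where "r \<in> {..<m} \<rightarrow> {1..M}" "inj_on r {..<m}"
    "x \<in> {..<m} \<rightarrow> {1..N}" "inj_on x {..<m}"
    "g \<in> {..<m} \<rightarrow> {Plus, Minus}" "staircase m A r x g"
proof -
  have mem: "S (Suc t) \<in> intersection_family M N A" if "t \<le> m" for t
    using chain that by (auto simp: is_strict_chain_def)
  have chain_step: "S (Suc t) \<subset> S (Suc (Suc t))" if "t < m" for t
    using chain that by (auto simp: is_strict_chain_def)
  have mono: "S (Suc s) \<subseteq> S (Suc t)" if "s \<le> t" "t \<le> m" for s t
    using that
  proof (induction t rule: dec_induct)
    case (step n)
    then show ?case
      using chain_step[of n] by auto
  qed simp
  have subN: "S (Suc t) \<subseteq> {1..N}" if "t \<le> m" for t
  proof -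
    obtain \<F> where \<F>: "\<F> \<noteq> {}" "\<F> \<subseteq> row_family M N A" "S (Suc t) = \<Inter>\<F>"
      using mem[of t] \<open>t \<le> m\<close> by (auto simp: intersection_family_def)
    then have "\<exists>G\<in>row_family M N A. S (Suc t) \<subseteq> G"
      by blast
    then show ?thesis
      by (auto simp: row_family_def row_pos_def row_neg_def)
  qed
  have ex: "\<exists>i g y. i \<in> {1..M} \<and> g \<in> {Plus, Minus} \<and> (\<forall>j\<in>S (Suc t). A (i, j) = g) \<and>
      y \<in> S (Suc (Suc t)) \<and> A (i, y) \<noteq> g" if t: "t < m" for t
  proof -
    obtain \<F> where \<F>: "\<F> \<subseteq> row_family M N A" "S (Suc t) = \<Inter>\<F>"
      using mem[of t] t unfolding intersection_family_def by auto
    obtain y where y: "y \<in> S (Suc (Suc t))" "y \<notin> \<Inter>\<F>"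
      using chain_step[OF t] \<F>(2) by blast
    then obtain G where G: "G \<in> \<F>" "y \<notin> G"
      by blast
    have yN: "y \<in> {1..N}"
      using subN[of "Suc t"] t y by auto
    have SG: "S (Suc t) \<subseteq> G"
      using \<F> G by blast
    have "G \<in> row_family M N A"
      using \<F> G by blast
    then obtain i where "i \<in> {1..M}" "G = row_pos N A i \<or> G = row_neg N A i"
      by (auto simp: row_family_def)
    then show ?thesis
      using SG G(2) y(1) yN by (auto simp: row_pos_def row_neg_def)
  qed
  obtain r g x where *: "\<And>t. t < m \<Longrightarrow> r t \<in> {1..M} \<and> g t \<in> {Plus, Minus} \<and>
      (\<forall>j\<in>S (Suc t). A (r t, j) = g t) \<and> x t \<in> S (Suc (Suc t)) \<and> A (r t, x t) \<noteq> g t"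
    using ex by metis
  have below: "A (r t, x s) = g t" if "s < t" "t < m" for s t
    using *[of t] *[of s] mono[of "Suc s" t] that by auto
  have xN: "x t \<in> {1..N}" if "t < m" for t
    using *[OF that] subN[of "Suc t"] that by auto
  obtain x0 where "x0 \<in> S (Suc 0)"
    using mem[of 0] by (auto simp: intersection_family_def)
  then have x0: "A (r t, x0) = g t" if "t < m" for t
    using *[OF that] mono[of 0 t] that by auto
  show ?thesis
  proof (rule that[of r x g])
    show "inj_on x {..<m}"
      by (rule linorder_inj_onI) (use * below in \<open>metis lessThan_iff\<close>, auto)
    \<comment> \<open>The sign \<open>g t\<close> is read off in the column \<open>x0\<close> common to all sets, so equal rows would have equal signs.\<close>
    show "inj_on r {..<m}"
      by (rule linorder_inj_onI) (use * below x0 in \<open>metis lessThan_iff\<close>, auto)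
    have "A (r t, x t) = opposite (g t)" if "t < m" for t
      using total[of "r t" "x t"] *[OF that] xN[OF that] by (cases "g t") auto
    then show "staircase m A r x g"
      using below by (auto simp: staircase_def)
  qed (use * xN in auto)
qed

section \<open>The height of a random sign matrix\<close>

lemma prob_prescribed_entries_le:
  assumes P: "P \<subseteq> {1..N} \<times> {1..N}"
  shows "measure_pmf.prob (random_sign_matrix N) {A. \<forall>p\<in>P. A p = v p} \<le> (1/2) ^ card P"
proof -
  let ?G = "{1..N} \<times> {1..N}"
  let ?B = "\<lambda>p. if p \<in> P then {v p} else UNIV"
  have "{A. \<forall>p\<in>P. A p = v p} = Pi ?G ?B"
    using P by (fastforce simp: Pi_def)
  then have "measure_pmf.prob (random_sign_matrix N) {A. \<forall>p\<in>P. A p = v p}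
      = (\<Prod>p\<in>?G. measure_pmf.prob (pmf_of_set {Plus, Minus}) (?B p))"
    by (simp add: random_sign_matrix_def measure_Pi_pmf_Pi)
  also have "\<dots> \<le> (\<Prod>p\<in>?G. if p \<in> P then 1/2 else 1)"
    by (intro prod_mono) (auto simp: measure_pmf_single indicator_def)
  also have "\<dots> = (1/2) ^ card P"
    using P by (simp add: prod.If_cases Int_absorb1)
  finally show ?thesis .
qed

lemma card_staircase_cells: "2 * card (SIGMA t:{..<m}. {..t}) = m * (m + 1)"
  by (induction m) auto

lemma prob_staircase_le:
  assumes r: "r \<in> {..<m} \<rightarrow> {1..N}" "inj_on r {..<m}" and x: "x \<in> {..<m} \<rightarrow> {1..N}" "inj_on x {..<m}"
  shows "measure_pmf.prob (random_sign_matrix N) {A. staircase m A r x g}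
    \<le> (1/2) ^ card (SIGMA t:{..<m}. {..t})"
proof -
  let ?I = "SIGMA t:{..<m}. {..t}"
  let ?c = "\<lambda>(t, s). (r t, x s)"
  let ?v = "\<lambda>(t, s). if s < t then g t else opposite (g t)"
  have inj: "inj_on ?c ?I"
    using r(2) x(2) by (auto simp: inj_on_def)
  have "staircase m A r x g \<longleftrightarrow> (\<forall>q\<in>?I. A (?c q) = ?v q)" for A
    by (auto simp: staircase_def)
  then have "{A. staircase m A r x g} = {A. \<forall>p\<in>?c ` ?I. A p = (?v \<circ> the_inv_into ?I ?c) p}"
    by (simp add: the_inv_into_f_f[OF inj] del: split_paired_Ball_Sigma cong: ball_cong)
  moreover have "?c ` ?I \<subseteq> {1..N} \<times> {1..N}"
    using r(1) x(1) by fastforce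
  ultimately show ?thesis
    using prob_prescribed_entries_le[of "?c ` ?I" N "?v \<circ> the_inv_into ?I ?c"]
    by (simp only: card_image[OF inj])
qed

lemma entries_random_sign_matrix:
  assumes "A \<in> set_pmf (random_sign_matrix N)" "i \<in> {1..N}" "j \<in> {1..N}"
  shows "A (i, j) \<in> {Plus, Minus}"
  using assms by (auto simp: random_sign_matrix_def set_Pi_pmf PiE_dflt_def)

text \<open>
  The union bound runs over rows, columns and signs, taken as extensional functions to make their
  number finite. Injectivity of the rows and columns is essential: it makes the prescribed cells
  distinct, so that each costs a factor of one half.
\<close>

lemma prob_sign_height_gt_le:
  "measure_pmf.prob (random_sign_matrix N) {A. m < sign_height N N A}
    \<le> real N ^ (2 * m) * 2 ^ m * (1/2) ^ card (SIGMA t:{..<m}. {..t})"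
proof -
  let ?p = "random_sign_matrix N" and ?q = "(1/2) ^ card (SIGMA t:{..<m}. {..t}) :: real"
  define J where "J = ({..<m} \<rightarrow>\<^sub>E {1..N}) \<times> ({..<m} \<rightarrow>\<^sub>E {1..N}) \<times> ({..<m} \<rightarrow>\<^sub>E {Plus, Minus})"
  define I where "I = {(r, x, g) \<in> J. inj_on r {..<m} \<and> inj_on x {..<m}}"
  define E where "E = (\<lambda>(r, x, g). {A. staircase m A r x g})"
  have "finite J"
    by (auto simp: J_def intro!: finite_PiE)
  then have fI: "finite I"
    by (rule rev_finite_subset) (auto simp: I_def)
  have "{A. m < sign_height N N A} \<inter> set_pmf ?p \<subseteq> (\<Union>i\<in>I. E i)"
  proof clarify
    fix A assume h: "m < sign_height N N A" and A: "A \<in> set_pmf ?p"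
    have "sign_height N N A \<in> {k. \<exists>S. is_strict_chain (intersection_family N N A) k S}"
      unfolding sign_height_def
      using finite_chain_lengths zero_chain_length by (intro Max_in) blast+
    then obtain S where "is_strict_chain (intersection_family N N A) (sign_height N N A) S"
      by blast
    then have "is_strict_chain (intersection_family N N A) (Suc m) S"
      using h by (auto simp: is_strict_chain_def)
    then obtain r x g where *: "r \<in> {..<m} \<rightarrow> {1..N}" "inj_on r {..<m}"
        "x \<in> {..<m} \<rightarrow> {1..N}" "inj_on x {..<m}"
        "g \<in> {..<m} \<rightarrow> {Plus, Minus}" "staircase m A r x g"
      using staircase_of_chain entries_random_sign_matrix[OF A] by metis
    let ?i = "(restrict r {..<m}, restrict x {..<m}, restrict g {..<m})"
    have "?i \<in> I"
      using * by (simp add: I_def J_def)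
    moreover have "A \<in> E ?i"
      using *(6) by (auto simp: E_def staircase_def)
    ultimately show "A \<in> (\<Union>i\<in>I. E i)"
      by blast
  qed
  then have "measure_pmf.prob ?p {A. m < sign_height N N A} \<le> measure_pmf.prob ?p (\<Union>i\<in>I. E i)"
    by (metis measure_Int_set_pmf measure_pmf.finite_measure_mono sets_measure_pmf UNIV_I)
  also have "\<dots> \<le> (\<Sum>i\<in>I. measure_pmf.prob ?p (E i))"
    by (rule measure_pmf.finite_measure_subadditive_finite[OF fI]) simp
  also have "\<dots> \<le> (\<Sum>i\<in>I. ?q)"
  proof (intro sum_mono)
    fix i assume i: "i \<in> I"
    obtain r x g where "i = (r, x, g)"
      by (cases i)
    then show "measure_pmf.prob ?p (E i) \<le> ?q"
      using i prob_staircase_le[of r m N x g] by (simp add: I_def J_def E_def PiE_iff Pi_iff)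
  qed
  also have "\<dots> = real (card I) * ?q"
    by simp
  also have "\<dots> \<le> real (card J) * ?q"
    using \<open>finite J\<close> by (intro mult_right_mono) (auto simp: I_def intro!: card_mono)
  also have "card J = N ^ (2 * m) * 2 ^ m"
    by (simp add: J_def card_PiE card_cartesian_product mult_2 power_add numeral_2_eq_2)
  finally show ?thesis
    by simp
qed

text \<open>
  With \<open>L = log 2 N \<ge> 1\<close> and \<open>m\<close> the integer part of \<open>7 L\<close>, one has \<open>m \<ge> 6 L\<close>, and the exponent
  \<open>2 m L + m - m (m + 1) / 2\<close> of the union bound is at most
  \<open>m\<^sup>2 / 3 + m / 2 - m\<^sup>2 / 2 = - m (m - 3) / 6\<close>, which is at most \<open>- L\<close> because \<open>m \<ge> 6\<close>.
\<close>

lemma prob_sign_height_gt_log_le: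
  assumes "N \<ge> 2"
  shows "measure_pmf.prob (random_sign_matrix N) {A. 7 * log 2 (real N) < real (sign_height N N A)}
    \<le> 1 / real N"
proof -
  define L where "L = log 2 (real N)"
  define m where "m = nat \<lfloor>7 * L\<rfloor>"
  define c where "c = card (SIGMA t:{..<m}. {..t})"
  have L: "1 \<le> L"
    using assms by (simp add: L_def)
  have N: "real N = 2 powr L"
    using assms by (simp add: L_def)
  have m: "6 * L \<le> real m" "real m \<le> 7 * L"
    using L unfolding m_def by linarith+
  have "real (2 * c) = real (m * (m + 1))"
    unfolding c_def by (simp only: card_staircase_cells)
  then have c: "real c = real m * (real m + 1) / 2"
    by (simp add: algebra_simps)
  have "{A. 7 * L < real (sign_height N N A)} \<subseteq> {A. m < sign_height N N A}"
    using m by auto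
  then have "measure_pmf.prob (random_sign_matrix N) {A. 7 * L < real (sign_height N N A)}
      \<le> measure_pmf.prob (random_sign_matrix N) {A. m < sign_height N N A}"
    by (intro measure_pmf.finite_measure_mono) auto
  also have "\<dots> \<le> real N ^ (2 * m) * 2 ^ m * (1/2) ^ c"
    unfolding c_def by (rule prob_sign_height_gt_le)
  also have "\<dots> = 2 powr (2 * m * L + m - c)"
    by (simp add: N powr_power powr_add powr_diff powr_realpow power_divide mult_ac)
  also have "\<dots> \<le> 2 powr (- L)"
  proof -
    have "6 * (m * L) \<le> real m * m"
      using mult_left_mono[OF m(1), of m] by simp
    moreover have "6 * real m \<le> real m * m"
      using mult_left_mono[of 6 "real m" "real m"] m L by simp
    ultimately have "2 * m * L + m - c \<le> - L"
      using m(1) unfolding c by (simp add: field_simps)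
    then show ?thesis
      by simp
  qed
  also have "\<dots> = 1 / real N"
    by (simp add: N powr_minus_divide)
  finally show ?thesis
    by (simp add: L_def)
qed

theorem theorem29:
  shows "\<exists>C::real. C > 0 \<and>
    (\<lambda>N. measure_pmf.prob (random_sign_matrix N)
            {A. real (sign_height N N A) \<le> C * log 2 (real N)}) \<longlonglongrightarrow> 1 \<and>
    (\<forall>N\<ge>1. \<forall>A \<in> set_pmf (random_sign_matrix N).
        real (sign_height N N A) \<le> C * log 2 (real N) \<longrightarrow>
        ereal_of_enat (ind_Z2 (sign_complex N N A) flip) \<le> ereal (2 * C * log 2 (real N)))"
proof (intro exI[of _ 7] conjI allI ballI impI)
  let ?P = "\<lambda>N. measure_pmf.prob (random_sign_matrix N)
            {A. real (sign_height N N A) \<le> 7 * log 2 (real N)}"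
  have lower: "1 - 1 / real N \<le> ?P N" if "N \<ge> 2" for N
  proof -
    have "?P N = 1 - measure_pmf.prob (random_sign_matrix N)
        (- {A. real (sign_height N N A) \<le> 7 * log 2 (real N)})"
      by (subst measure_pmf.prob_compl[of _ "random_sign_matrix N", simplified, symmetric])
        (simp_all add: Compl_eq_Diff_UNIV double_diff)
    also have "- {A. real (sign_height N N A) \<le> 7 * log 2 (real N)}
        = {A. 7 * log 2 (real N) < real (sign_height N N A)}"
      by auto
    finally show ?thesis
      using prob_sign_height_gt_log_le[OF that] by simp
  qed
  have "(\<lambda>N. 1 - 1 / real N) \<longlonglongrightarrow> 1 - 0"
    by (intro tendsto_intros lim_1_over_n)
  then have lim: "(\<lambda>N. 1 - 1 / real N) \<longlonglongrightarrow> 1"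
    by simp
  show "?P \<longlonglongrightarrow> 1"
    by (rule tendsto_sandwich[OF _ _ lim tendsto_const])
      (auto intro!: eventually_sequentiallyI[of 2] lower)
next
  fix N A
  assume h: "real (sign_height N N A) \<le> 7 * log 2 (real N)"
  have "ereal_of_enat (ind_Z2 (sign_complex N N A) flip)
      \<le> ereal_of_enat (enat (2 * sign_height N N A))"
    by (simp only: ereal_of_enat_le_iff ind_Z2_sign_complex_le)
  also have "\<dots> \<le> ereal (2 * 7 * log 2 (real N))"
    using h by simp
  finally show "ereal_of_enat (ind_Z2 (sign_complex N N A) flip) \<le> ereal (2 * 7 * log 2 (real N))" .
qed simp

end
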